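(* Let $\varepsilon>0$. There is a constant $C=C(\varepsilon)$ such that for every integer $\ell\geq 1$, every upper triangular $g=\begin{pmatrix}z&u\\&z^{-1}\end{pmatrix}\in\mathrm{SL}_2(\mathbb{C})$, every $\nu\in i\mathbb{R}$ and every $k\in K$, $$\bigl|\varphi_{\nu,\ell}^{\ell}(k^{-1}gk)\bigr|\leq C\min\left(\ell,\ \frac{\ell^{\varepsilon}\|g\|^6}{|z^2-1|^2},\ \frac{\ell^{1/2+\varepsilon}\|g\|^3}{|u|}\right),$$ where an expression with zero denominator is understood as $+\infty$.
   Context: $G=\mathrm{SL}_2(\mathbb{C})$, $K=\mathrm{SU}_2(\mathbb{C})$ with probability Haar measure $dk$. $\|g\|=\sqrt{\mathrm{tr}(gg^* )}$ is the Frobenius norm. The spherical trace function is $$\varphi_{\nu,\ell}^{\ell}(g)=(2\ell+1)\int_K\psi_\ell(\kappa(k^{-1}gk))\,e^{(\nu-1)\rho(H(gk))}\,dk,$$ where $\psi_\ell\left(\begin{pmatrix}\alpha&\beta\\-\bar\beta&\bar\alpha\end{pmatrix}\right)=\bar\alpha^{2\ell}$ on $K$, and $\kappa$, $H$ are the projections for the Iwasawa decomposition $G=KAN$ ($A$ positive diagonal, $N$ upper triangular unipotent matrices). Explicitly, for $g=\begin{pmatrix}a&b\\c&d\end{pmatrix}$, $\kappa(g)\in K$ has first column $(a,c)^\top/\sqrt{|a|^2+|c|^2}$, and $e^{(\nu-1)\rho(H(g))}=(|a|^2+|c|^2)^{\nu-1}$. *)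

theory Defs
  imports "HOL-Probability.Probability"
begin

definition mat2 :: "complex \<Rightarrow> complex \<Rightarrow> complex \<Rightarrow> complex \<Rightarrow> complex^2^2" where
  "mat2 a b c d = vector [vector [a, b], vector [c, d]]"

definition conj_transpose :: "complex^'n^'m \<Rightarrow> complex^'m^'n" where
  "conj_transpose A = (\<chi> i j. cnj (A $ j $ i))"

definition SL2 :: "(complex^2^2) set" where
  "SL2 = {g. det g = 1}"

definition SU2 :: "(complex^2^2) set" where
  "SU2 = {k. det k = 1 \<and> k ** conj_transpose k = mat 1}"

definition frobenius_norm :: "complex^2^2 \<Rightarrow> real" where
  "frobenius_norm g = sqrt (Re (trace (g ** conj_transpose g)))"

text \<open>A Haar probability measure on a group \<open>G\<close> of matrices: a left-invariant Borel probability
  measure on \<open>G\<close>.  On a compact group such as \<^const>\<open>SU2\<close> it exists and is unique.\<close>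

definition haar_prob_measure :: "(complex^2^2) set \<Rightarrow> (complex^2^2) measure \<Rightarrow> bool" where
  "haar_prob_measure G \<mu> \<longleftrightarrow>
     prob_space \<mu> \<and> space \<mu> = G \<and> sets \<mu> = sets (restrict_space borel G) \<and>
     (\<forall>h\<in>G. distr \<mu> \<mu> (\<lambda>k. h ** k) = \<mu>)"

text \<open>The Lie algebra of \<open>A\<close> is identified with the reals via \<open>t \<mapsto> diag (t, -t)\<close>, so that
  \<open>iwasawa_exp t\<close> is the exponential map onto \<open>A\<close>.\<close>

definition iwasawa_exp :: "real \<Rightarrow> complex^2^2" where
  "iwasawa_exp t = mat2 (of_real (exp t)) 0 0 (of_real (exp (- t)))"

definition iwasawa_N :: "(complex^2^2) set" where
  "iwasawa_N = range (\<lambda>x. mat2 1 x 0 1)"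

definition kappa :: "complex^2^2 \<Rightarrow> complex^2^2" where
  "kappa g = (THE k. k \<in> SU2 \<and> (\<exists>t. \<exists>n\<in>iwasawa_N. g = k ** iwasawa_exp t ** n))"

definition iwasawa_H :: "complex^2^2 \<Rightarrow> real" where
  "iwasawa_H g = (THE t. \<exists>k\<in>SU2. \<exists>n\<in>iwasawa_N. g = k ** iwasawa_exp t ** n)"

text \<open>Half the sum of the positive roots: the only positive root sends \<open>diag (t, -t)\<close> to \<open>2 * t\<close>
  and has real multiplicity 2.\<close>

definition rho :: "real \<Rightarrow> real" where
  "rho t = 2 * t"

text \<open>Only meant for arguments in \<^const>\<open>SU2\<close>.\<close>

definition psi :: "nat \<Rightarrow> complex^2^2 \<Rightarrow> complex" where
  "psi l k = cnj (k $ 1 $ 1) ^ (2 * l)"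

definition spherical_trace ::
    "(complex^2^2) measure \<Rightarrow> complex \<Rightarrow> nat \<Rightarrow> complex^2^2 \<Rightarrow> complex" where
  "spherical_trace \<mu> \<nu> l g =
     of_nat (2 * l + 1) *
     (\<integral>k. psi l (kappa (matrix_inv k ** g ** k)) *
          exp ((\<nu> - 1) * of_real (rho (iwasawa_H (g ** k)))) \<partial>\<mu>)"

text \<open>The following facts confirm that the Iwasawa projections are well defined on \<^const>\<open>SL2\<close>
  and given by the usual explicit formulas.\<close>

lemma mat2_nth [simp]:
  "mat2 a b c d $ 1 $ 1 = a" "mat2 a b c d $ 1 $ 2 = b"
  "mat2 a b c d $ 2 $ 1 = c" "mat2 a b c d $ 2 $ 2 = d"
  by (simp_all add: mat2_def)

lemma mat2_eq_iff:
  "(A :: complex^2^2) = B \<longleftrightarrow>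
     A$1$1 = B$1$1 \<and> A$1$2 = B$1$2 \<and> A$2$1 = B$2$1 \<and> A$2$2 = B$2$2"
  by (auto simp: vec_eq_iff forall_2)

lemma mat2_mult: "mat2 a b c d ** mat2 a' b' c' d' =
  mat2 (a*a' + b*c') (a*b' + b*d') (c*a' + d*c') (c*b' + d*d')"
  by (simp add: mat2_eq_iff matrix_matrix_mult_def sum_2)

lemma mat2_collapse: "mat2 (A$1$1) (A$1$2) (A$2$1) (A$2$2) = A"
  by (simp add: mat2_eq_iff)

lemma frobenius_norm_eq_norm: "frobenius_norm g = norm g"
  by (simp add: frobenius_norm_def norm_vec_def L2_set_def trace_def sum_2
      matrix_matrix_mult_def conj_transpose_def complex_norm_square [symmetric]
      flip: of_real_power)

lemma SU2_iff:
  "k \<in> SU2 \<longleftrightarrow> k$2$2 = cnj (k$1$1) \<and> k$1$2 = - cnj (k$2$1) \<and>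
     (cmod (k$1$1))\<^sup>2 + (cmod (k$2$1))\<^sup>2 = 1"
proof -
  define a b c d where "a = k$1$1" and "b = k$1$2" and "c = k$2$1" and "d = k$2$2"
  have k: "k = mat2 a b c d"
    by (simp add: a_def b_def c_def d_def mat2_collapse)
  have ct: "conj_transpose k = mat2 (cnj a) (cnj c) (cnj b) (cnj d)"
    by (simp add: conj_transpose_def k mat2_eq_iff)
  have one: "mat 1 = mat2 1 0 0 1"
    by (simp add: mat2_eq_iff mat_def)
  have mem: "k \<in> SU2 \<longleftrightarrow> a*d - b*c = 1 \<and> a*cnj a + b*cnj b = 1 \<and> a*cnj c + b*cnj d = 0 \<and>
      c*cnj a + d*cnj b = 0 \<and> c*cnj c + d*cnj d = 1"
    unfolding SU2_def mem_Collect_eq ct one by (simp add: k det_2 mat2_mult mat2_eq_iff)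
  have nrm: "(cmod a)\<^sup>2 + (cmod c)\<^sup>2 = 1 \<longleftrightarrow> a*cnj a + c*cnj c = 1"
    by (metis complex_norm_square of_real_add of_real_eq_1_iff)
  show ?thesis
    unfolding a_def [symmetric] b_def [symmetric] c_def [symmetric] d_def [symmetric] mem nrm
  proof (intro iffI, goal_cases)
    case 1
    then have e: "a*d - b*c = 1" "a*cnj a + b*cnj b = 1" "c*cnj a + d*cnj b = 0"
      "c*cnj c + d*cnj d = 1" by auto
    have "d = cnj a" using e(1-3) by algebra
    moreover have "cnj b = - c" using e(1-3) by algebra
    then have "b = - cnj c" by (metis complex_cnj_cnj complex_cnj_minus)
    ultimately show ?case using e by (simp add: algebra_simps)
  next
    case 2
    then show ?case by (auto simp: algebra_simps)
  qed
qed

lemma col_pos: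
  assumes "g \<in> SL2"
  shows "(cmod (g$1$1))\<^sup>2 + (cmod (g$2$1))\<^sup>2 > 0"
proof -
  have "g$1$1 \<noteq> 0 \<or> g$2$1 \<noteq> 0" using assms by (auto simp: SL2_def det_2)
  then show ?thesis by (auto intro: add_pos_nonneg add_nonneg_pos)
qed

lemma iwasawa_unique:
  assumes "k \<in> SU2" "n \<in> iwasawa_N" "g = k ** iwasawa_exp t ** n"
  defines "r \<equiv> sqrt ((cmod (g$1$1))\<^sup>2 + (cmod (g$2$1))\<^sup>2)"
  shows "exp t = r"
    and "k = mat2 (g$1$1 / r) (- cnj (g$2$1) / r) (g$2$1 / r) (cnj (g$1$1) / r)"
proof -
  obtain x where n: "n = mat2 1 x 0 1" using assms(2) by (auto simp: iwasawa_N_def)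
  have g: "g = mat2 (k$1$1) (k$1$2) (k$2$1) (k$2$2) ** iwasawa_exp t ** n"
    using assms(3) by (simp add: mat2_collapse)
  have g1: "g$1$1 = k$1$1 * of_real (exp t)" "g$2$1 = k$2$1 * of_real (exp t)"
    unfolding g n iwasawa_exp_def mat2_mult by simp_all
  note K = SU2_iff [THEN iffD1, OF assms(1)]
  have "(cmod (g$1$1))\<^sup>2 + (cmod (g$2$1))\<^sup>2 =
      ((cmod (k$1$1))\<^sup>2 + (cmod (k$2$1))\<^sup>2) * (exp t)\<^sup>2"
    unfolding g1 by (simp add: norm_mult power_mult_distrib algebra_simps)
  then show r: "exp t = r" using K by (simp add: r_def)
  have "r \<noteq> 0" using r by (metis exp_not_eq_zero)
  then show "k = mat2 (g$1$1 / r) (- cnj (g$2$1) / r) (g$2$1 / r) (cnj (g$1$1) / r)"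
    using K by (simp add: mat2_eq_iff g1 r)
qed

lemma iwasawa_exists:
  assumes "g \<in> SL2"
  shows "\<exists>k\<in>SU2. \<exists>t. \<exists>n\<in>iwasawa_N. g = k ** iwasawa_exp t ** n"
proof -
  define a b c d where "a = g$1$1" and "b = g$1$2" and "c = g$2$1" and "d = g$2$2"
  define r where "r = sqrt ((cmod a)\<^sup>2 + (cmod c)\<^sup>2)"
  define R where "R = complex_of_real r"
  have g: "g = mat2 a b c d"
    by (simp add: a_def b_def c_def d_def mat2_collapse)
  have det: "a*d - b*c = 1" using assms by (simp add: SL2_def det_2 g)
  have pos: "(cmod a)\<^sup>2 + (cmod c)\<^sup>2 > 0" using col_pos [OF assms] by (simp add: a_def c_def)
  then have r: "r > 0" "r\<^sup>2 = (cmod a)\<^sup>2 + (cmod c)\<^sup>2" by (simp_all add: r_def)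
  have R0: "R \<noteq> 0" using r by (simp add: R_def)
  have R2: "R * R = a * cnj a + c * cnj c"
    unfolding R_def complex_norm_square [symmetric]
    by (metis of_real_add of_real_mult of_real_power power2_eq_square r(2))
  define k where "k = mat2 (a / R) (- cnj c / R) (c / R) (cnj a / R)"
  define X where "X = cnj a * b + cnj c * d"
  define n where "n = mat2 1 (X / (R * R)) 0 1"
  have "k \<in> SU2"
    using r pos by (auto simp: SU2_iff k_def R_def norm_divide power_divide
        add_divide_distrib [symmetric])
  moreover have "n \<in> iwasawa_N" by (simp add: n_def iwasawa_N_def)
  moreover have "iwasawa_exp (ln r) = mat2 R 0 0 (1 / R)"
    using r by (simp add: iwasawa_exp_def R_def exp_minus field_simps)
  moreover have "g = k ** mat2 R 0 0 (1 / R) ** n"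
  proof -
    have "b * (R * R) = a * X - cnj c"
      unfolding R2 X_def using det by algebra
    moreover have "d * (R * R) = c * X + cnj a"
      unfolding R2 X_def using det by algebra
    then have "b = (a * X - cnj c) / (R * R)" "d = (c * X + cnj a) / (R * R)"
      using R0 calculation by (simp_all add: nonzero_eq_divide_eq)
    then show ?thesis
      unfolding g k_def n_def mat2_mult using R0
      by (simp add: mat2_eq_iff diff_divide_distrib add_divide_distrib)
  qed
  ultimately show ?thesis by metis
qed

lemma kappa_eq:
  assumes "g \<in> SL2"
  defines "r \<equiv> sqrt ((cmod (g$1$1))\<^sup>2 + (cmod (g$2$1))\<^sup>2)"
  shows "kappa g = mat2 (g$1$1 / r) (- cnj (g$2$1) / r) (g$2$1 / r) (cnj (g$1$1) / r)"
proof -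
  obtain k t n where *: "k \<in> SU2" "n \<in> iwasawa_N" "g = k ** iwasawa_exp t ** n"
    using iwasawa_exists [OF assms(1)] by blast
  have "kappa g = k"
    unfolding kappa_def
    using * iwasawa_unique(2) by (intro the_equality) (blast, metis)
  then show ?thesis using iwasawa_unique(2) [OF *] by (simp add: r_def)
qed

lemma exp_rho_iwasawa_H:
  fixes \<nu> :: complex
  assumes "g \<in> SL2"
  shows "exp ((\<nu> - 1) * of_real (rho (iwasawa_H g))) =
    of_real ((cmod (g$1$1))\<^sup>2 + (cmod (g$2$1))\<^sup>2) powr (\<nu> - 1)"
proof -
  let ?s = "(cmod (g$1$1))\<^sup>2 + (cmod (g$2$1))\<^sup>2"
  obtain k t n where *: "k \<in> SU2" "n \<in> iwasawa_N" "g = k ** iwasawa_exp t ** n"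
    using iwasawa_exists [OF assms] by blast
  have "iwasawa_H g = t"
    unfolding iwasawa_H_def
    using * iwasawa_unique(1) by (intro the_equality) (blast, metis exp_inj_iff)
  moreover have "exp t = sqrt ?s" using iwasawa_unique(1) [OF *] .
  then have "t = ln (sqrt ?s)" by (metis ln_exp)
  then have "ln ?s = 2 * t" using col_pos [OF assms] by (simp add: ln_sqrt)
  ultimately show ?thesis
    using col_pos [OF assms] by (auto simp: powr_def rho_def Ln_of_real simp del: of_real_add)
qed

end

(* Conjugation by SU(2) disappears by invariance of the Haar measure. If (x, y) is the first column
   of k, the first column of k^-1 g k has squared length s = |z x + u y|^2 + |y / z|^2 and second
   entry of modulus w = |y| |(z - 1/z) x + u y|. The modulus of the integrand is therefore
   (1 - w^2/s)^l / s <= l^(-\<theta>) w^(-2 \<theta>) s^(\<theta> - 1) for 0 <= \<theta> <= 1, where s >= |g|^(-2).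

   It remains to integrate negative powers of a product of two linear forms in (x, y). A single
   form of norm 1 has finite moments of every order > -2, independent of the form: a set where it
   is at most t has measure O(t^2), because about t^(-2) translates of it are disjoint. For two
   forms y and a x + b y, either the larger factor is bounded below in terms of |a|, which gives
   exponents below 2, or the product is split by AM-GM, which gives exponents below 1. *)

theory Submission
  imports Defs
begin

section \<open>Haar measure of small caps\<close>

lemma measurable_entry [measurable]: "(\<lambda>k :: complex^2^2. k $ i $ j) \<in> borel_measurable borel"
  by (intro borel_measurable_continuous_onI continuous_intros)

lemma conj_transpose_mult: "conj_transpose (h ** k) = conj_transpose k ** conj_transpose h"
  by (simp add: conj_transpose_def matrix_matrix_mult_def vec_eq_iff mult.commute)

lemma SU2_mult:
  assumes "h \<in> SU2" "k \<in> SU2"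
  shows "h ** k \<in> SU2"
proof -
  have "(h ** k) ** conj_transpose (h ** k) = h ** (k ** conj_transpose k) ** conj_transpose h"
    by (simp add: conj_transpose_mult matrix_mul_assoc)
  then show ?thesis using assms by (simp add: SU2_def det_mul)
qed

locale haar_SU2 =
  fixes \<mu> :: "(complex^2^2) measure"
  assumes haar: "haar_prob_measure SU2 \<mu>"

sublocale haar_SU2 \<subseteq> prob_space \<mu>
  using haar by (simp add: haar_prob_measure_def)

context haar_SU2
begin

lemma space_haar: "space \<mu> = SU2"
  using haar by (simp add: haar_prob_measure_def)

text \<open>The sigma-algebra of \<open>\<mu>\<close> is the trace on \<open>SU2\<close> of the
  Borel sets, so measurability can be checked on the whole matrix space.\<close>

lemma measurable_haarI:
  assumes "f \<in> measurable borel N"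
  shows "f \<in> measurable \<mu> N"
proof -
  have "sets \<mu> = sets (restrict_space borel SU2)"
    using haar by (simp add: haar_prob_measure_def)
  from measurable_cong_sets [OF this refl] show ?thesis
    using measurable_restrict_space1 [OF assms] by blast
qed

lemma nn_integral_haar_left:
  assumes h: "h \<in> SU2" and f: "f \<in> borel_measurable borel"
  shows "(\<integral>\<^sup>+k. f (h ** k) \<partial>\<mu>) = (\<integral>\<^sup>+k. f k \<partial>\<mu>)"
proof -
  have sets: "sets \<mu> = sets (restrict_space borel SU2)"
    using haar by (simp add: haar_prob_measure_def)
  have "(\<lambda>k. h ** k) \<in> borel_measurable borel"
    unfolding matrix_matrix_mult_def
    by (intro borel_measurable_continuous_onI continuous_intros)
  then have "(\<lambda>k. h ** k) \<in> measurable \<mu> (restrict_space borel SU2)"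
    by (intro measurable_restrict_space2 measurable_haarI)
       (auto simp: space_haar intro: SU2_mult h)
  then have "(\<lambda>k. h ** k) \<in> measurable \<mu> \<mu>"
    using measurable_cong_sets [OF refl sets] by blast
  then have "(\<integral>\<^sup>+k. f (h ** k) \<partial>\<mu>) = (\<integral>\<^sup>+k. f k \<partial>distr \<mu> \<mu> (\<lambda>k. h ** k))"
    by (subst nn_integral_distr) (auto intro: measurable_haarI f)
  also have "distr \<mu> \<mu> (\<lambda>k. h ** k) = \<mu>"
    using haar h by (simp add: haar_prob_measure_def)
  finally show ?thesis .
qed

text \<open>The normalised coefficients (a, b)/L form the first row of some h in \<open>SU2\<close>.
  The linear form over L then has the modulus of the upper-left entry of \<open>h ** k\<close>, and
  left invariance removes h.\<close>

lemma nn_integral_linear_form: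
  assumes L: "L\<^sup>2 = (cmod a)\<^sup>2 + (cmod b)\<^sup>2" "L > 0" and f: "f \<in> borel_measurable borel"
  shows "(\<integral>\<^sup>+k. f (cmod (a * k$1$1 + b * k$2$1) / L) \<partial>\<mu>) = (\<integral>\<^sup>+k. f (cmod (k$1$1)) \<partial>\<mu>)"
proof -
  define h where "h = mat2 (a / L) (b / L) (- cnj (b / L)) (cnj (a / L))"
  have "(cmod a)\<^sup>2 + (cmod b)\<^sup>2 > 0" using L by (metis zero_less_power)
  then have "a = 0 \<longrightarrow> b \<noteq> 0" by auto
  then have "h \<in> SU2"
    using L by (simp add: SU2_iff h_def norm_divide power_divide add_divide_distrib [symmetric])
  moreover have "cmod ((h ** k) $ 1 $ 1) = cmod (a * k$1$1 + b * k$2$1) / L" for k :: "complex^2^2"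
    using L(2)
    by (simp add: h_def matrix_matrix_mult_def sum_2 add_divide_distrib [symmetric] norm_divide)
  ultimately show ?thesis
    using nn_integral_haar_left [of h "\<lambda>k. f (cmod (k$1$1))"] f by simp
qed

lemma sets_haarI [measurable]: "Measurable.pred borel P \<Longrightarrow> {k \<in> SU2. P k} \<in> sets \<mu>"
  using predE [OF measurable_haarI, of P] unfolding space_haar .

lemma emeasure_linear_form:
  assumes L: "L\<^sup>2 = (cmod a)\<^sup>2 + (cmod b)\<^sup>2" "L > 0" and B: "B \<in> sets borel"
  shows "emeasure \<mu> {k \<in> SU2. cmod (a * k$1$1 + b * k$2$1) / L \<in> B} =
    emeasure \<mu> {k \<in> SU2. cmod (k$1$1) \<in> B}"
proof -
  have em: "emeasure \<mu> {k \<in> SU2. f k \<in> B} = (\<integral>\<^sup>+k. indicator B (f k) \<partial>\<mu>)"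
    if "f \<in> borel_measurable borel" for f :: "complex^2^2 \<Rightarrow> real"
  proof -
    have "{k \<in> SU2. f k \<in> B} \<in> sets \<mu>" using that B by measurable
    then have "emeasure \<mu> {k \<in> SU2. f k \<in> B} = (\<integral>\<^sup>+k. indicator {k \<in> SU2. f k \<in> B} k \<partial>\<mu>)"
      by simp
    also have "\<dots> = (\<integral>\<^sup>+k. indicator B (f k) \<partial>\<mu>)"
      by (rule nn_integral_cong) (auto simp: space_haar indicator_def)
    finally show ?thesis .
  qed
  show ?thesis
    using nn_integral_linear_form [OF L, of "indicator B"] B by (simp add: em)
qed

text \<open>The sets where \<open>k\<^sub>1\<^sub>1 + \<zeta> k\<^sub>2\<^sub>1\<close> is small, for \<open>\<zeta>\<close> in a square grid of mesh \<open>1/m\<close>,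
  are disjoint, and they contain translates of the set in question.\<close>

lemma haar_small_entry:
  assumes m: "m > 0"
  shows "measure \<mu> {k \<in> SU2. cmod (k$1$1) \<le> 1 / (10 * real m)} \<le> 1 / (real m)\<^sup>2"
proof -
  \<comment> \<open>The factor 10 makes the sets \<open>E p\<close> disjoint: a common point would
    have |y| <= 2/5 and |x| <= 4/5, but 4/25 + 16/25 < 1.\<close>
  define t where "t = 1 / (10 * real m)"
  have t: "t > 0" "t \<le> 1/10" using m by (auto simp: t_def field_simps)
  define Z where "Z = (\<lambda>(i, j). Complex (real i / real m) (real j / real m))"
  define L where "L = (\<lambda>p. sqrt (1 + (cmod (Z p))\<^sup>2))"
  define E where "E = (\<lambda>p. {k \<in> SU2. cmod (1 * k$1$1 + Z p * k$2$1) / L p \<le> t})"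
  define S where "S = {..<m} \<times> {..<m}"
  have L: "(L p)\<^sup>2 = (cmod 1)\<^sup>2 + (cmod (Z p))\<^sup>2" "L p > 0" for p
    by (auto simp: L_def add_pos_nonneg)
  have Z2: "(cmod (Z p))\<^sup>2 \<le> 2" if S: "p \<in> S" for p
  proof -
    obtain i j where p: "p = (i, j)" "i < m" "j < m"
      using S by (auto simp: S_def)
    have "(real i / m)\<^sup>2 \<le> 1" "(real j / m)\<^sup>2 \<le> 1"
      using p by (auto intro!: power_le_one simp: divide_le_eq)
    then show ?thesis by (simp add: Z_def p cmod_power2)
  qed
  have Zle: "cmod (Z p) \<le> 3/2" and Lle: "L p \<le> 2" if "p \<in> S" for p
  proof -
    show "cmod (Z p) \<le> 3/2"
      by (rule power2_le_imp_le) (use Z2 [OF that] in \<open>auto simp: power2_eq_square\<close>)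
    show "L p \<le> 2"
      unfolding L_def by (rule real_le_lsqrt) (use Z2 [OF that] in auto)
  qed
  have sep: "1 / m \<le> cmod (Z p - Z q)" if "p \<noteq> q" for p q
  proof -
    obtain i j i' j' where p: "p = (i, j)" "q = (i', j')" by (metis surj_pair)
    have "1 / m \<le> \<bar>real a / m - real b / m\<bar>" if "a \<noteq> b" for a b :: nat
    proof -
      have "1 \<le> \<bar>real a - real b\<bar>" using that by linarith
      then show ?thesis using m by (simp add: diff_divide_distrib [symmetric] divide_right_mono)
    qed
    moreover have "i \<noteq> i' \<or> j \<noteq> j'" using that p by auto
    moreover have "\<bar>real i / m - real i' / m\<bar> \<le> cmod (Z p - Z q)"
      using abs_Re_le_cmod [of "Z p - Z q"] by (simp add: Z_def p)
    moreover have "\<bar>real j / m - real j' / m\<bar> \<le> cmod (Z p - Z q)"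
      using abs_Im_le_cmod [of "Z p - Z q"] by (simp add: Z_def p)
    ultimately show ?thesis by (metis order_trans)
  qed
  have "disjoint_family_on E S"
    unfolding disjoint_family_on_def
  proof (intro ballI impI equals0I)
    fix p q k assume p: "p \<in> S" "q \<in> S" "p \<noteq> q" and k: "k \<in> E p \<inter> E q"
    define x y where "x = k$1$1" and "y = k$2$1"
    have b: "cmod (x + Z p * y) \<le> 2 * t" if "p \<in> S" "k \<in> E p" for p
    proof -
      have "cmod (x + Z p * y) \<le> L p * t"
        using that L(2) [of p] by (simp add: E_def x_def y_def divide_le_eq mult.commute)
      also have "\<dots> \<le> 2 * t" using Lle [OF that(1)] t by (intro mult_right_mono) auto
      finally show ?thesis .
    qed
    \<comment> \<open>Subtracting the two small forms eliminates \<open>x\<close>, and the grid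
      spacing then forces \<open>y\<close> to be small.\<close>
    have "1 / m * cmod y \<le> cmod (Z p - Z q) * cmod y"
      using sep [OF p(3)] by (rule mult_right_mono) auto
    also have "\<dots> = cmod ((x + Z p * y) - (x + Z q * y))"
      by (simp add: norm_mult [symmetric] algebra_simps)
    also have "\<dots> \<le> 2 * t + 2 * t"
      by (rule norm_triangle_le_diff) (use b [of p] b [of q] k p in auto)
    finally have y: "cmod y \<le> 2/5" using m by (simp add: t_def field_simps)
    have "cmod x \<le> cmod (x + Z p * y) + cmod (Z p * y)"
      by (metis add_diff_cancel norm_triangle_ineq4)
    also have "\<dots> \<le> 2 * t + 3/2 * (2/5)"
      unfolding norm_mult using b [of p] k p y Zle [of p] by (intro add_mono mult_mono) auto
    finally have x: "cmod x \<le> 4/5" using t by simp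
    have "(cmod x)\<^sup>2 \<le> (4/5)\<^sup>2" "(cmod y)\<^sup>2 \<le> (2/5)\<^sup>2"
      using x y by (auto intro!: power_mono simp del: power_divide)
    moreover have "k \<in> SU2" using k by (simp add: E_def)
    then have "(cmod x)\<^sup>2 + (cmod y)\<^sup>2 = 1" by (simp add: SU2_iff x_def y_def)
    ultimately show False by (simp add: power2_eq_square)
  qed
  moreover have "E ` S \<subseteq> sets \<mu>" by (auto simp: E_def)
  ultimately have "(\<Sum>p\<in>S. measure \<mu> (E p)) = measure \<mu> (\<Union>p\<in>S. E p)"
    by (intro finite_measure_finite_Union [symmetric]) (auto simp: S_def)
  also have "\<dots> \<le> 1" by simp
  finally have "(\<Sum>p\<in>S. measure \<mu> (E p)) \<le> 1" .
  \<comment> \<open>By invariance all m^2 disjoint sets have the measure of the cap, so that measure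
    is at most 1/m^2.\<close>
  moreover have "measure \<mu> (E p) = measure \<mu> {k \<in> SU2. cmod (k$1$1) \<le> t}" for p
  proof -
    have "emeasure \<mu> (E p) = emeasure \<mu> {k \<in> SU2. cmod (k$1$1) \<le> t}"
      using emeasure_linear_form [OF L, of "{..t}"] by (simp add: E_def)
    then show ?thesis by (simp add: measure_def)
  qed
  ultimately have "real m * real m * measure \<mu> {k \<in> SU2. cmod (k$1$1) \<le> t} \<le> 1"
    by (simp add: S_def)
  then show ?thesis using m by (simp add: t_def field_simps power2_eq_square)
qed

section \<open>Negative moments of linear forms on the sphere\<close>

text \<open>The zero set of the upper-left entry lies in every cap of
  \<open>haar_small_entry\<close>, hence is null. Invariance carries this over to any nonzero
  form.\<close>

lemma AE_linear_form_nonzero: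
  assumes "a \<noteq> 0 \<or> b \<noteq> 0"
  shows "AE k in \<mu>. a * k$1$1 + b * k$2$1 \<noteq> 0"
proof -
  define L where "L = sqrt ((cmod a)\<^sup>2 + (cmod b)\<^sup>2)"
  have L: "L\<^sup>2 = (cmod a)\<^sup>2 + (cmod b)\<^sup>2" "L > 0"
    using assms by (auto simp: L_def intro: add_pos_nonneg add_nonneg_pos)
  define A where "A = {k \<in> SU2. cmod (k$1$1) \<in> {0}}"
  have A: "measure \<mu> A \<le> 1 / (real m)\<^sup>2" if "m > 0" for m
  proof -
    have "measure \<mu> A \<le> measure \<mu> {k \<in> SU2. cmod (k$1$1) \<le> 1 / (10 * real m)}"
      by (rule finite_measure_mono) (auto simp: A_def)
    then show ?thesis using haar_small_entry [OF that] by linarith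
  qed
  then have "eventually (\<lambda>m. measure \<mu> A \<le> 1 / (real m)\<^sup>2) sequentially"
    by (rule eventually_mono [OF eventually_gt_at_top [of 0]]) (auto intro: A)
  moreover have "(\<lambda>m. 1 / (real m)\<^sup>2) \<longlonglongrightarrow> 0" by real_asymp
  ultimately have "measure \<mu> A \<le> 0"
    by (intro tendsto_lowerbound [of _ 0 sequentially]) auto
  then have "emeasure \<mu> A = 0" by (simp add: emeasure_eq_measure measure_le_0_iff)
  then have "emeasure \<mu> {k \<in> SU2. cmod (a * k$1$1 + b * k$2$1) / L \<in> {0}} = 0"
    using emeasure_linear_form [OF L, of "{0}"] by (simp add: A_def)
  then show ?thesis
    using L(2) by (intro AE_I [where N = "{k \<in> SU2. cmod (a * k$1$1 + b * k$2$1) / L \<in> {0}}"])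
      (auto simp: space_haar)
qed

text \<open>\<open>enn2real\<close> sends infinity to 0, so equality with the integral rests on
  \<open>neg_moment_finite\<close>, that is on 0 < p < 2.\<close>

definition neg_moment :: "real \<Rightarrow> real" where
  "neg_moment p = enn2real (\<integral>\<^sup>+k. ennreal (cmod (k$1$1) powr - p) \<partial>\<mu>)"

lemma neg_moment_nonneg: "neg_moment p \<ge> 0"
  by (simp add: neg_moment_def)

text \<open>Dyadic decomposition: where the entry is about 2^(-n)/10, its power is at most (20 *
  2^n)^p, on a set of measure at most 4^(-n). The resulting geometric series has ratio 2^p/4 <
  1.\<close>

lemma neg_moment_finite:
  assumes p: "0 < p" "p < 2"
  shows "(\<integral>\<^sup>+k. ennreal (cmod (k$1$1) powr - p) \<partial>\<mu>) < \<infinity>"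
proof -
  define T where "T = (\<lambda>n. {k \<in> SU2. cmod (k$1$1) \<le> 1 / (10 * real (2 ^ n))})"
  define w where "w = (\<lambda>n. 20 powr p * (2 powr p) ^ n)"
  have T: "T n \<in> sets \<mu>" for n unfolding T_def by measurable
  have term_le: "f n \<le> suminf f" for f :: "nat \<Rightarrow> ennreal" and n
    using sum_le_suminf [of f "{n}"] by simp
  have pt: "ennreal (cmod (k$1$1) powr - p) \<le>
      ennreal (10 powr p) + (\<Sum>n. ennreal (w n) * indicator (T n) k)" if k: "k \<in> SU2" for k
  proof -
    define a where "a = cmod (k$1$1)"
    consider "a = 0" | "a > 1/10" | "a > 0" "a \<le> 1/10"
      using norm_ge_zero [of "k$1$1"] unfolding a_def [symmetric] by linarith
    then show ?thesis
    proof cases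
      \<comment> \<open>\<open>powr\<close> with base 0 is 0, so nothing has to be bounded
        here.\<close>
      case 1 then show ?thesis by (simp add: a_def)
    next
      case 2
      have "a powr - p = (1 / a) powr p" using 2 by (simp add: powr_minus_divide powr_divide)
      also have "\<dots> \<le> 10 powr p"
        using 2 p by (intro powr_mono2) (auto simp: field_simps)
      finally show ?thesis
        unfolding a_def by (intro add_increasing2 ennreal_leI zero_le)
    next
      case 3
      \<comment> \<open>If no dyadic shell contained \<open>a\<close>, induction would put
        \<open>a\<close> below every 1/(10 * 2^n), contradicting a > 0.\<close>
      have "\<exists>n. a \<le> 1 / (10 * 2 ^ n) \<and> a > 1 / (10 * 2 ^ Suc n)"
      proof (rule ccontr)
        assume *: "\<nexists>n. a \<le> 1 / (10 * 2 ^ n) \<and> a > 1 / (10 * 2 ^ Suc n)"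
        have le: "a \<le> 1 / (10 * 2 ^ n)" for n
        proof (induction n)
          case 0 then show ?case using 3 by simp
        next
          case (Suc n) then show ?case using * not_le by blast
        qed
        obtain N where "(1/2) ^ N < 10 * a"
          using real_arch_pow_inv [of "10 * a" "1/2"] 3 by auto
        then show False using le [of N] by (simp add: field_simps)
      qed
      then obtain n where n: "a \<le> 1 / (10 * 2 ^ n)" "a > 1 / (10 * 2 ^ Suc n)" by blast
      have "a powr - p = (1 / a) powr p" using 3 by (simp add: powr_minus_divide powr_divide)
      also have "\<dots> \<le> (20 * 2 ^ n) powr p"
        using 3 n p by (intro powr_mono2) (auto simp: field_simps)
      also have "\<dots> = w n"
        by (simp add: w_def powr_mult powr_powr powr_power mult.commute flip: powr_realpow)
      finally have "ennreal (a powr - p) \<le> ennreal (w n) * indicator (T n) k"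
        using n k by (simp add: T_def a_def ennreal_leI)
      also have "\<dots> \<le> (\<Sum>n. ennreal (w n) * indicator (T n) k)"
        by (rule term_le)
      finally show ?thesis unfolding a_def by (intro add_increasing zero_le)
    qed
  qed
  have "(\<integral>\<^sup>+k. ennreal (cmod (k$1$1) powr - p) \<partial>\<mu>) \<le>
      (\<integral>\<^sup>+k. ennreal (10 powr p) + (\<Sum>n. ennreal (w n) * indicator (T n) k) \<partial>\<mu>)"
    by (intro nn_integral_mono pt) (simp add: space_haar)
  also have "\<dots> = ennreal (10 powr p) + (\<Sum>n. ennreal (w n) * emeasure \<mu> (T n))"
    using T by (simp add: nn_integral_add nn_integral_suminf nn_integral_cmult emeasure_space_1)
  also have "(\<Sum>n. ennreal (w n) * emeasure \<mu> (T n)) \<le> (\<Sum>n. ennreal (20 powr p * (2 powr p / 4) ^ n))"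
  proof (intro suminf_le)
    fix n
    have "w n * measure \<mu> (T n) \<le> w n * (1 / (real (2 ^ n))\<^sup>2)"
      unfolding T_def by (intro mult_left_mono haar_small_entry) (auto simp: w_def)
    also have "\<dots> = 20 powr p * (2 powr p / 4) ^ n"
      by (simp add: w_def power_divide power_mult_distrib power2_eq_square flip: power_mult_distrib)
    finally show "ennreal (w n) * emeasure \<mu> (T n) \<le> ennreal (20 powr p * (2 powr p / 4) ^ n)"
      by (simp add: emeasure_eq_measure w_def ennreal_leI flip: ennreal_mult)
  qed auto
  also have "ennreal (10 powr p) + (\<Sum>n. ennreal (20 powr p * (2 powr p / 4) ^ n)) < \<infinity>"
  proof -
    have "2 powr p < (2::real) powr 2" using p by (intro powr_less_mono) auto
    then have "summable (\<lambda>n. 20 powr p * (2 powr p / 4) ^ n)"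
      by (intro summable_mult summable_geometric) auto
    then have "(\<Sum>n. ennreal (20 powr p * (2 powr p / 4) ^ n)) \<noteq> \<top>"
      by (intro ennreal_suminf_neq_top) auto
    then show ?thesis by (simp add: less_top)
  qed
  finally show ?thesis by (simp add: add_left_mono)
qed

lemma nn_integral_linear_form_powr:
  assumes L: "L\<^sup>2 = (cmod a)\<^sup>2 + (cmod b)\<^sup>2" "L > 0" and p: "0 < p" "p < 2"
  shows "(\<integral>\<^sup>+k. ennreal ((cmod (a * k$1$1 + b * k$2$1) / L) powr - p) \<partial>\<mu>) = ennreal (neg_moment p)"
  using nn_integral_linear_form [OF L, of "\<lambda>t. ennreal (t powr - p)"] neg_moment_finite [OF p]
  by (simp add: neg_moment_def)

text \<open>Shared by the two product estimates below, which both majorise the product by such a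
  sum. The entry \<open>k$2$1\<close> is itself a form of norm 1, so both summands have the same
  moment.\<close>

lemma nn_integral_sum_powr:
  assumes L: "L\<^sup>2 = (cmod a)\<^sup>2 + (cmod b)\<^sup>2" "L > 0" and p: "0 < p" "p < 2" and c: "c \<ge> 0"
  shows "(\<integral>\<^sup>+k. ennreal (c * (cmod (k$2$1) powr - p +
      (cmod (a * k$1$1 + b * k$2$1) / L) powr - p)) \<partial>\<mu>) = ennreal (c * (2 * neg_moment p))"
proof -
  have y: "(\<integral>\<^sup>+k. ennreal (cmod (k$2$1) powr - p) \<partial>\<mu>) = ennreal (neg_moment p)"
    using nn_integral_linear_form_powr [of 1 0 1, OF _ _ p] by simp
  have "(\<integral>\<^sup>+k. ennreal (c * (cmod (k$2$1) powr - p +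
      (cmod (a * k$1$1 + b * k$2$1) / L) powr - p)) \<partial>\<mu>) =
    (\<integral>\<^sup>+k. ennreal c * (ennreal (cmod (k$2$1) powr - p) +
      ennreal ((cmod (a * k$1$1 + b * k$2$1) / L) powr - p)) \<partial>\<mu>)"
    using c by (simp add: ennreal_mult)
  also have "\<dots> = ennreal c * (ennreal (neg_moment p) + ennreal (neg_moment p))"
    by (subst nn_integral_cmult nn_integral_add; (intro measurable_haarI)?; measurable?)
       (simp add: nn_integral_add measurable_haarI y nn_integral_linear_form_powr [OF L p])
  finally show ?thesis
    using c neg_moment_nonneg [of p] by (simp add: ennreal_mult flip: ennreal_plus)
qed

text \<open>On the unit sphere the two factors cannot be small simultaneously.\<close>

lemma nn_integral_product_powr:
  assumes a: "a \<noteq> 0" and p: "0 < p" "p < 2"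
  shows "(\<integral>\<^sup>+k. ennreal ((cmod (k$2$1) * cmod (a * k$1$1 + b * k$2$1)) powr - p) \<partial>\<mu>)
    \<le> ennreal (18 * neg_moment p * cmod a powr - p)"
proof -
  define L where "L = sqrt ((cmod a)\<^sup>2 + (cmod b)\<^sup>2)"
  have L: "L\<^sup>2 = (cmod a)\<^sup>2 + (cmod b)\<^sup>2" "L > 0"
    using a by (auto simp: L_def intro: add_pos_nonneg)
  have Lab: "cmod a \<le> L" "cmod b \<le> L"
    by (auto simp: L_def intro!: real_le_rsqrt)
  define c where "c = (cmod a / 3) powr - p"
  have pt: "(cmod (k$2$1) * cmod (a * k$1$1 + b * k$2$1)) powr - p \<le>
      c * (cmod (k$2$1) powr - p + (cmod (a * k$1$1 + b * k$2$1) / L) powr - p)"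
    if k: "k \<in> SU2" for k
  proof -
    define x y where "x = k$1$1" and "y = k$2$1"
    define r where "r = cmod (a * x + b * y)"
    have xy: "(cmod x)\<^sup>2 + (cmod y)\<^sup>2 = 1" using k by (simp add: SU2_iff x_def y_def)
    \<comment> \<open>The threshold for \<open>y\<close> ensures |b y| <= |a|/3 below it. In the
      fourth case |a x| <= r + |b y| gives |x| <= 2/3, while |y| <= 1/3, which is impossible on the
      unit sphere.\<close>
    consider "y = 0 \<or> r = 0" | "y \<noteq> 0" "r > 0" "cmod y \<ge> cmod a / (3 * L)"
      | "y \<noteq> 0" "r > 0" "r \<ge> cmod a / 3" | "cmod y < cmod a / (3 * L)" "r < cmod a / 3"
      unfolding r_def by fastforce
    then have "(cmod y * r) powr - p \<le> c * (cmod y powr - p + (r / L) powr - p)"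
    proof cases
      case 1 then show ?thesis by (auto simp: c_def)
    next
      case 2
      have "(cmod y * r) powr - p \<le> (cmod a / (3 * L) * r) powr - p"
        using 2 a L p by (intro powr_mono2' mult_right_mono mult_pos_pos) auto
      also have "cmod a / (3 * L) * r = (cmod a / 3) * (r / L)" by simp
      also have "\<dots> powr - p = c * (r / L) powr - p"
        using 2 L by (simp only: powr_mult c_def)
      also have "\<dots> \<le> c * (cmod y powr - p + (r / L) powr - p)"
        by (intro mult_left_mono) (auto simp: c_def)
      finally show ?thesis .
    next
      case 3
      have "(cmod y * r) powr - p \<le> (cmod y * (cmod a / 3)) powr - p"
        using 3 a L p by (intro powr_mono2' mult_left_mono mult_pos_pos) auto
      also have "\<dots> = c * cmod y powr - p"
        by (simp only: powr_mult c_def mult.commute)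
      also have "\<dots> \<le> c * (cmod y powr - p + (r / L) powr - p)"
        by (intro mult_left_mono) (auto simp: c_def)
      finally show ?thesis .
    next
      case 4
      have "cmod a / (3 * L) \<le> 1/3" using Lab(1) L(2) by (simp add: field_simps)
      then have y: "cmod y \<le> 1/3" using 4 by linarith
      have "cmod b * cmod y \<le> L * (cmod a / (3 * L))"
        using 4 Lab L(2) by (intro mult_mono) auto
      then have b_y: "cmod (b * y) \<le> cmod a / 3" using L(2) by (simp add: norm_mult)
      have "cmod (a * x) \<le> r + cmod (b * y)"
        unfolding r_def by (metis add_diff_cancel norm_triangle_ineq4)
      then have "cmod a * cmod x \<le> cmod a * (2/3)"
        using b_y 4 by (simp add: norm_mult)
      then have x: "cmod x \<le> 2/3" using a by simp
      have "(cmod x)\<^sup>2 \<le> (2/3)\<^sup>2" "(cmod y)\<^sup>2 \<le> (1/3)\<^sup>2"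
        using x y by (auto intro!: power_mono simp del: power_divide)
      with xy show ?thesis by (simp add: power2_eq_square)
    qed
    then show ?thesis by (simp add: r_def x_def y_def)
  qed
  have "(\<integral>\<^sup>+k. ennreal ((cmod (k$2$1) * cmod (a * k$1$1 + b * k$2$1)) powr - p) \<partial>\<mu>) \<le>
    (\<integral>\<^sup>+k. ennreal (c * (cmod (k$2$1) powr - p +
      (cmod (a * k$1$1 + b * k$2$1) / L) powr - p)) \<partial>\<mu>)"
    by (intro nn_integral_mono ennreal_leI pt) (simp add: space_haar)
  also have "\<dots> = ennreal (c * (2 * neg_moment p))"
    by (rule nn_integral_sum_powr [OF L p]) (simp add: c_def)
  also have "\<dots> \<le> ennreal (18 * neg_moment p * cmod a powr - p)"
  proof (rule ennreal_leI)
    have "3 powr p \<le> (3::real) powr 2" using p by (intro powr_mono) auto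
    then have "3 powr p * cmod a powr - p \<le> 9 * cmod a powr - p"
      by (intro mult_right_mono) auto
    moreover have "c = 3 powr p * cmod a powr - p"
      using a by (simp add: c_def powr_divide powr_minus field_simps)
    ultimately have "c \<le> 9 * cmod a powr - p" by simp
    then show "c * (2 * neg_moment p) \<le> 18 * neg_moment p * cmod a powr - p"
      using mult_right_mono [of c "9 * cmod a powr - p" "2 * neg_moment p"] neg_moment_nonneg [of p]
      by (simp add: mult_ac)
  qed
  finally show ?thesis .
qed

text \<open>AM-GM bounds the product of the two powers by the sum of their squares. This doubles the
  exponent, whence p < 1, but the bound involves only \<open>L\<close> and survives when
  \<open>a\<close> tends to 0.\<close>

lemma nn_integral_product_powr':
  assumes L: "L\<^sup>2 = (cmod a)\<^sup>2 + (cmod b)\<^sup>2" "L > 0" and p: "0 < p" "p < 1"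
  shows "(\<integral>\<^sup>+k. ennreal ((cmod (k$2$1) * cmod (a * k$1$1 + b * k$2$1)) powr - p) \<partial>\<mu>)
    \<le> ennreal (L powr - p * (2 * neg_moment (2 * p)))"
proof -
  have pt: "(cmod (k$2$1) * cmod (a * k$1$1 + b * k$2$1)) powr - p \<le>
      L powr - p * (cmod (k$2$1) powr - (2 * p) +
        (cmod (a * k$1$1 + b * k$2$1) / L) powr - (2 * p))" for k :: "complex^2^2"
  proof -
    define s t where "s = cmod (k$2$1)" and "t = cmod (a * k$1$1 + b * k$2$1) / L"
    have st: "s \<ge> 0" "t \<ge> 0" using L by (auto simp: s_def t_def)
    have "2 * (s powr - p * t powr - p) \<le> (s powr - p)\<^sup>2 + (t powr - p)\<^sup>2"
      using sum_squares_bound [of "s powr - p" "t powr - p"] by simp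
    moreover have "(s powr - p)\<^sup>2 = s powr - (2 * p)" "(t powr - p)\<^sup>2 = t powr - (2 * p)"
      by (simp_all add: power2_eq_square flip: powr_add)
    moreover have "s powr - p * t powr - p \<ge> 0" by simp
    ultimately have "s powr - p * t powr - p \<le> s powr - (2 * p) + t powr - (2 * p)"
      by linarith
    then have "L powr - p * (s powr - p * t powr - p) \<le> L powr - p * (s powr - (2 * p) + t powr - (2 * p))"
      by (intro mult_left_mono) auto
    moreover have "(s * (L * t)) powr - p = L powr - p * (s powr - p * t powr - p)"
      by (simp only: powr_mult mult_ac)
    moreover have "L * t = cmod (a * k$1$1 + b * k$2$1)" using L(2) by (simp add: t_def)
    ultimately show ?thesis by (simp add: s_def t_def)
  qed
  have "(\<integral>\<^sup>+k. ennreal ((cmod (k$2$1) * cmod (a * k$1$1 + b * k$2$1)) powr - p) \<partial>\<mu>) \<le>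
    (\<integral>\<^sup>+k. ennreal (L powr - p * (cmod (k$2$1) powr - (2 * p) +
        (cmod (a * k$1$1 + b * k$2$1) / L) powr - (2 * p))) \<partial>\<mu>)"
    by (intro nn_integral_mono ennreal_leI pt)
  also have "\<dots> = ennreal (L powr - p * (2 * neg_moment (2 * p)))"
    using p by (intro nn_integral_sum_powr [OF L]) auto
  finally show ?thesis .
qed

end

section \<open>The modulus of the integrand\<close>

lemma conj_transpose_SU2: "k \<in> SU2 \<Longrightarrow> conj_transpose k \<in> SU2"
  by (auto simp: SU2_iff conj_transpose_def)

lemma matrix_inv_SU2:
  assumes "k \<in> SU2"
  shows "matrix_inv k = conj_transpose k"
proof -
  have k: "k ** conj_transpose k = mat 1" using assms by (simp add: SU2_def)
  then have "conj_transpose k ** k = mat 1" by (simp add: matrix_left_right_inverse)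
  with k have "\<exists>A. k ** A = mat 1 \<and> A ** k = mat 1" by blast
  then have "matrix_inv k ** k = mat 1" unfolding matrix_inv_def by (rule someI2_ex) simp
  then have "matrix_inv k ** k ** conj_transpose k = conj_transpose k" by simp
  then show ?thesis by (simp add: k flip: matrix_mul_assoc)
qed

lemma SU2_column_norm:
  assumes "k \<in> SU2"
  shows "(cmod ((k ** A)$1$1))\<^sup>2 + (cmod ((k ** A)$2$1))\<^sup>2 = (cmod (A$1$1))\<^sup>2 + (cmod (A$2$1))\<^sup>2"
proof -
  define a b X Y where "a = k$1$1" and "b = k$2$1" and "X = A$1$1" and "Y = A$2$1"
  have K: "k$2$2 = cnj a" "k$1$2 = - cnj b" "(cmod a)\<^sup>2 + (cmod b)\<^sup>2 = 1"
    using assms by (auto simp: SU2_iff a_def b_def)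
  \<comment> \<open>In terms of conjugates this is a polynomial identity, hence within reach of
    \<open>algebra\<close>.\<close>
  have "complex_of_real ((cmod (a * X - cnj b * Y))\<^sup>2 + (cmod (b * X + cnj a * Y))\<^sup>2) =
      complex_of_real (((cmod a)\<^sup>2 + (cmod b)\<^sup>2) * ((cmod X)\<^sup>2 + (cmod Y)\<^sup>2))"
    by (simp only: of_real_add of_real_mult complex_norm_square
          complex_cnj_add complex_cnj_diff complex_cnj_mult complex_cnj_cnj) algebra
  then have "(cmod (a * X - cnj b * Y))\<^sup>2 + (cmod (b * X + cnj a * Y))\<^sup>2 =
      (cmod X)\<^sup>2 + (cmod Y)\<^sup>2"
    unfolding of_real_eq_iff K by simp
  then show ?thesis
    using K by (simp add: matrix_matrix_mult_def sum_2 a_def b_def X_def Y_def)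
qed

text \<open>For g with rows (z, u) and (0, 1/z), this is the squared length of the first column of g
  k, and equally of k^-1 g k.\<close>

definition column_norm :: "complex \<Rightarrow> complex \<Rightarrow> complex^2^2 \<Rightarrow> real" where
  "column_norm z u k = (cmod (z * k$1$1 + u * k$2$1))\<^sup>2 + (cmod (inverse z * k$2$1))\<^sup>2"

text \<open>The modulus of the lower-left entry of k^-1 g k.\<close>

definition offdiag :: "complex \<Rightarrow> complex \<Rightarrow> complex^2^2 \<Rightarrow> real" where
  "offdiag z u k = cmod (k$2$1) * cmod ((z - inverse z) * k$1$1 + u * k$2$1)"

text \<open>The power is the modulus of the \<open>psi\<close> factor, its base being the squared
  modulus of the upper-left entry of \<open>kappa\<close>. The last division comes from the exponent
  \<nu> - 1 with Re \<nu> = 0.\<close>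

definition trace_kernel :: "complex \<Rightarrow> complex \<Rightarrow> nat \<Rightarrow> complex^2^2 \<Rightarrow> real" where
  "trace_kernel z u l k =
     ((column_norm z u k - (offdiag z u k)\<^sup>2) / column_norm z u k) ^ l / column_norm z u k"

lemma measurable_column_norm [measurable]: "column_norm z u \<in> borel_measurable borel"
  unfolding column_norm_def by measurable

lemma measurable_offdiag [measurable]: "offdiag z u \<in> borel_measurable borel"
  unfolding offdiag_def by measurable

lemma measurable_trace_kernel [measurable]: "trace_kernel z u l \<in> borel_measurable borel"
  unfolding trace_kernel_def by measurable

lemma frobenius_norm_upper:
  "(frobenius_norm (mat2 z u 0 w))\<^sup>2 = (cmod z)\<^sup>2 + (cmod u)\<^sup>2 + (cmod w)\<^sup>2"
  by (simp add: frobenius_norm_eq_norm norm_vec_def L2_set_def sum_2)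

text \<open>The moduli of \<open>z\<close> and \<open>inverse z\<close> have product 1, so their
  squares sum to at least 2; the other bounds keep a single entry.\<close>

lemma frobenius_norm_upper_ge:
  fixes z u :: complex
  assumes "z \<noteq> 0"
  defines "N \<equiv> frobenius_norm (mat2 z u 0 (inverse z))"
  shows "1 \<le> N" "cmod z \<le> N" "cmod u \<le> N" "cmod (inverse z) \<le> N"
proof -
  have N: "N\<^sup>2 = (cmod z)\<^sup>2 + (cmod u)\<^sup>2 + (cmod (inverse z))\<^sup>2"
    by (simp add: N_def frobenius_norm_upper)
  have N0: "N \<ge> 0" by (simp add: N_def frobenius_norm_eq_norm)
  have "2 * (cmod z * cmod (inverse z)) \<le> (cmod z)\<^sup>2 + (cmod (inverse z))\<^sup>2"
    using sum_squares_bound [of "cmod z" "cmod (inverse z)"] by simp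
  then have "2 \<le> (cmod z)\<^sup>2 + (cmod (inverse z))\<^sup>2"
    using assms(1) by (simp add: norm_inverse)
  then have "1\<^sup>2 \<le> N\<^sup>2" 
    unfolding N one_power2 using zero_le_power2 [of "cmod u"] by linarith
  then show "1 \<le> N" using N0 by (rule power2_le_imp_le)
  show "cmod z \<le> N" "cmod u \<le> N" "cmod (inverse z) \<le> N"
    by (rule power2_le_imp_le [OF _ N0], simp add: N)+
qed

text \<open>Let (X, Y) be the first column of g k. Applying g^-1, which has the same Frobenius norm
  as g, recovers the unit vector (x, y), so Cauchy-Schwarz gives the bound.\<close>

lemma column_norm_ge:
  assumes "z \<noteq> 0" "k \<in> SU2"
  shows "1 \<le> (frobenius_norm (mat2 z u 0 (inverse z)))\<^sup>2 * column_norm z u k"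
proof -
  define x y where "x = k$1$1" and "y = k$2$1"
  define X Y where "X = z * x + u * y" and "Y = inverse z * y"
  define a b c where "a = cmod (inverse z)" and "b = cmod u" and "c = cmod z"
  have "x = inverse z * X - u * Y" "y = z * Y"
    using assms(1) by (simp_all add: X_def Y_def field_simps)
  then have "cmod x \<le> a * cmod X + b * cmod Y" and y: "cmod y = c * cmod Y"
    by (metis a_def b_def norm_mult norm_triangle_ineq4) (simp add: c_def norm_mult \<open>y = z * Y\<close>)
  then have "(cmod x)\<^sup>2 \<le> (a * cmod X + b * cmod Y)\<^sup>2"
    by (intro power_mono) auto
  \<comment> \<open>Cauchy-Schwarz, with defect (a |Y| - b |X|)^2.\<close>
  also have "\<dots> \<le> (a\<^sup>2 + b\<^sup>2) * ((cmod X)\<^sup>2 + (cmod Y)\<^sup>2)"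
    using zero_le_power2 [of "a * cmod Y - b * cmod X"]
    by (simp add: power2_eq_square algebra_simps)
  finally have "(cmod x)\<^sup>2 + (cmod y)\<^sup>2 \<le> (a\<^sup>2 + b\<^sup>2) * ((cmod X)\<^sup>2 + (cmod Y)\<^sup>2) + c\<^sup>2 * (cmod Y)\<^sup>2"
    by (simp add: y power_mult_distrib)
  also have "\<dots> \<le> (c\<^sup>2 + b\<^sup>2 + a\<^sup>2) * ((cmod X)\<^sup>2 + (cmod Y)\<^sup>2)"
    by (simp add: algebra_simps)
  finally show ?thesis
    using assms(2)
    by (simp add: SU2_iff x_def y_def X_def Y_def frobenius_norm_upper column_norm_def a_def b_def c_def)
qed

lemma column_norm_pos:
  assumes "z \<noteq> 0" "k \<in> SU2"
  shows "column_norm z u k > 0"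
  using column_norm_ge [OF assms, of u]
  by (metis column_norm_def less_eq_real_def mult_zero_right not_one_le_zero sum_power2_ge_zero)

text \<open>The inverse of k is unitary, so on the left it preserves column lengths; the lower-left
  entry is multiplied out.\<close>

lemma upper_conj_column:
  fixes z u :: complex
  assumes "k \<in> SU2"
  defines "P \<equiv> matrix_inv k ** mat2 z u 0 (inverse z) ** k"
  shows "(cmod (P$1$1))\<^sup>2 + (cmod (P$2$1))\<^sup>2 = column_norm z u k"
    and "cmod (P$2$1) = offdiag z u k"
proof -
  have P: "P = conj_transpose k ** (mat2 z u 0 (inverse z) ** k)"
    by (simp add: P_def matrix_inv_SU2 [OF assms(1)] matrix_mul_assoc)
  show "(cmod (P$1$1))\<^sup>2 + (cmod (P$2$1))\<^sup>2 = column_norm z u k"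
    unfolding P by (subst SU2_column_norm [OF conj_transpose_SU2 [OF assms(1)]])
      (simp add: matrix_matrix_mult_def sum_2 column_norm_def)
  have "P$2$1 = - (k$2$1 * ((z - inverse z) * k$1$1 + u * k$2$1))"
    using assms(1) unfolding P
    by (simp add: SU2_iff matrix_matrix_mult_def sum_2 conj_transpose_def algebra_simps)
  then show "cmod (P$2$1) = offdiag z u k"
    by (simp only: norm_minus_cancel norm_mult offdiag_def)
qed

lemma offdiag_le:
  assumes "k \<in> SU2"
  shows "(offdiag z u k)\<^sup>2 \<le> column_norm z u k"
  using upper_conj_column [OF assms, of z u] by (metis le_add_same_cancel2 zero_le_power2)

lemma SU2_subset_SL2: "SU2 \<subseteq> SL2"
  by (auto simp: SU2_def SL2_def)

lemma SL2_mult: "g \<in> SL2 \<Longrightarrow> h \<in> SL2 \<Longrightarrow> g ** h \<in> SL2"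
  by (simp add: SL2_def det_mul)

text \<open>With q = h k, the argument of \<open>kappa\<close> is the conjugate of the triangular
  matrix by q, and that of \<open>iwasawa_H\<close> differs from it only by a unitary left factor.
  Both therefore have first columns of the same length.\<close>

lemma norm_trace_integrand:
  fixes z u \<nu> :: complex
  assumes z: "z \<noteq> 0" and h: "h \<in> SU2" and k: "k \<in> SU2" and nu: "Re \<nu> = 0"
  defines "g \<equiv> matrix_inv h ** mat2 z u 0 (inverse z) ** h"
  shows "norm (psi l (kappa (matrix_inv k ** g ** k)) *
      exp ((\<nu> - 1) * of_real (rho (iwasawa_H (g ** k))))) = trace_kernel z u l (h ** k)"
proof -
  define q where "q = h ** k"
  have q: "q \<in> SU2" unfolding q_def by (rule SU2_mult [OF h k])
  let ?g = "mat2 z u 0 (inverse z)"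
  define P W where "P = matrix_inv q ** ?g ** q" and "W = conj_transpose h ** (?g ** q)"
  have SL: "?g \<in> SL2" using z by (simp add: SL2_def det_2)
  have S: "conj_transpose h \<in> SL2" "conj_transpose q \<in> SL2" "q \<in> SL2"
    using h q conj_transpose_SU2 SU2_subset_SL2 by blast+
  have PW: "P \<in> SL2" "W \<in> SL2"
    unfolding P_def W_def matrix_inv_SU2 [OF q] by (intro SL2_mult SL S)+
  have eq: "matrix_inv k ** g ** k = P" "g ** k = W"
    unfolding g_def P_def W_def q_def matrix_inv_SU2 [OF h] matrix_inv_SU2 [OF k]
      matrix_inv_SU2 [OF SU2_mult [OF h k]] conj_transpose_mult
    by (simp_all add: matrix_mul_assoc)
  let ?s = "column_norm z u q"
  have s: "?s > 0" by (rule column_norm_pos [OF z q])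
  note P = upper_conj_column [OF q, of z u, folded P_def]
  have "kappa P $ 1 $ 1 = P$1$1 / complex_of_real (sqrt ?s)"
    by (simp only: kappa_eq [OF PW(1)] mat2_nth P(1))
  then have "norm (psi l (kappa P)) = ((cmod (P$1$1) / sqrt ?s)\<^sup>2) ^ l"
    using s by (simp add: psi_def norm_power norm_divide power_mult)
  also have "(cmod (P$1$1) / sqrt ?s)\<^sup>2 = (?s - (offdiag z u q)\<^sup>2) / ?s"
    using P s by (simp add: power_divide)
  finally have 1: "norm (psi l (kappa P)) = ((?s - (offdiag z u q)\<^sup>2) / ?s) ^ l" .
  have W: "(cmod (W$1$1))\<^sup>2 + (cmod (W$2$1))\<^sup>2 = ?s"
    unfolding W_def by (subst SU2_column_norm [OF conj_transpose_SU2 [OF h]])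
      (simp add: matrix_matrix_mult_def sum_2 column_norm_def)
  have "norm (exp ((\<nu> - 1) * of_real (rho (iwasawa_H W)))) = ?s powr (- 1)"
    unfolding exp_rho_iwasawa_H [OF PW(2)] W using s nu by (simp add: norm_powr_real_powr)
  then have 2: "norm (exp ((\<nu> - 1) * of_real (rho (iwasawa_H W)))) = 1 / ?s"
    using s by (simp add: powr_minus_divide)
  show ?thesis
    unfolding eq norm_mult 1 2 trace_kernel_def q_def by simp
qed

text \<open>With q = w^2/s, the power (1 - q)^l is at most exp(-l q), hence at most (l
  q)^(-\<theta>). The parameter \<theta> trades decay in l against the singularity in w.\<close>

lemma power_le_powr_bound:
  fixes s w N \<theta> :: real
  assumes l: "l \<ge> 1" and w: "w > 0" "w\<^sup>2 \<le> s" and N: "N > 0" "1 \<le> N\<^sup>2 * s" and \<theta>: "0 \<le> \<theta>" "\<theta> \<le> 1"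
  shows "((s - w\<^sup>2) / s) ^ l / s \<le> real l powr - \<theta> * N powr (2 - 2 * \<theta>) * w powr - (2 * \<theta>)"
proof -
  have s: "s > 0" using w by (meson less_le_trans zero_less_power)
  define q where "q = w\<^sup>2 / s"
  have q: "q > 0" "q \<le> 1" using w s by (auto simp: q_def)
  \<comment> \<open>Both 1 and 1/t bound exp(-t), and the smaller of them is at most t^(-\<theta>)
    for \<theta> in [0, 1].\<close>
  have exp_le: "exp (- t) \<le> t powr - \<theta>" if "t > 0" for t :: real
  proof (cases "t \<le> 1")
    case True
    have "exp (- t) \<le> 1" using that by simp
    also have "1 \<le> t powr - \<theta>" using True that \<theta> powr_mono2' [of "- \<theta>" t 1] by simp
    finally show ?thesis .
  next
    case False
    have "exp (- t) = 1 / exp t" by (simp add: exp_minus field_simps)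
    also have "\<dots> \<le> 1 / t"
      using that exp_ge_add_one_self [of t]
      by (intro divide_left_mono mult_pos_pos exp_gt_zero) linarith+
    also have "\<dots> = t powr - 1" using that by (simp add: powr_minus_divide)
    also have "\<dots> \<le> t powr - \<theta>" using False \<theta> by (intro powr_mono) auto
    finally show ?thesis .
  qed
  have "((s - w\<^sup>2) / s) ^ l = (1 - q) ^ l" using s by (simp add: q_def diff_divide_distrib)
  also have "\<dots> \<le> exp (- q) ^ l"
    using q exp_ge_add_one_self [of "- q"] by (intro power_mono) auto
  also have "\<dots> = exp (- (real l * q))" by (simp add: exp_of_nat_mult [symmetric])
  also have "\<dots> \<le> (real l * q) powr - \<theta>" using q l by (intro exp_le) auto
  also have "\<dots> = real l powr - \<theta> * w powr - (2 * \<theta>) * s powr \<theta>"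
    using w s by (simp add: q_def powr_mult powr_divide powr_minus powr_powr field_simps
        flip: powr_numeral)
  finally have "((s - w\<^sup>2) / s) ^ l / s \<le> real l powr - \<theta> * w powr - (2 * \<theta>) * s powr \<theta> / s"
    using s by (intro divide_right_mono) auto
  also have "\<dots> = real l powr - \<theta> * w powr - (2 * \<theta>) * s powr - (1 - \<theta>)"
    using s by (simp add: powr_diff)
  \<comment> \<open>The remaining exponent of \<open>s\<close> is at most 0, so the lower bound
    1/N^2 for \<open>s\<close> applies.\<close>
  also have "\<dots> \<le> real l powr - \<theta> * w powr - (2 * \<theta>) * N powr (2 - 2 * \<theta>)"
  proof (intro mult_left_mono)
    have "s powr - (1 - \<theta>) \<le> (1 / N\<^sup>2) powr - (1 - \<theta>)"
      using s N \<theta> by (intro powr_mono2') (auto simp: field_simps)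
    also have "\<dots> = (N powr 2) powr (1 - \<theta>)"
      using N by (simp add: powr_divide powr_minus_divide del: minus_diff_eq)
    also have "\<dots> = N powr (2 - 2 * \<theta>)" by (simp add: powr_powr algebra_simps)
    finally show "s powr - (1 - \<theta>) \<le> N powr (2 - 2 * \<theta>)" .
  qed auto
  finally show ?thesis by (simp add: mult_ac)
qed

section \<open>Bounds for the spherical trace, one for each term of the minimum\<close>

context haar_SU2
begin

lemma norm_spherical_trace_le:
  assumes z: "z \<noteq> 0" and h: "h \<in> SU2" and nu: "Re \<nu> = 0"
  shows "ennreal (cmod (spherical_trace \<mu> \<nu> l (matrix_inv h ** mat2 z u 0 (inverse z) ** h)))
    \<le> ennreal (2 * real l + 1) * (\<integral>\<^sup>+k. ennreal (trace_kernel z u l k) \<partial>\<mu>)"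
proof -
  define g where "g = matrix_inv h ** mat2 z u 0 (inverse z) ** h"
  define f where "f = (\<lambda>k. psi l (kappa (matrix_inv k ** g ** k)) *
      exp ((\<nu> - 1) * of_real (rho (iwasawa_H (g ** k)))))"
  \<comment> \<open>If \<open>f\<close> is not integrable, its Bochner integral is 0 by convention
    and the bound is trivial.\<close>
  have "ennreal (norm (integral\<^sup>L \<mu> f)) \<le> (\<integral>\<^sup>+k. ennreal (norm (f k)) \<partial>\<mu>)"
    by (cases "integrable \<mu> f") (auto simp: integral_norm_bound_ennreal not_integrable_integral_eq)
  also have "\<dots> = (\<integral>\<^sup>+k. ennreal (trace_kernel z u l (h ** k)) \<partial>\<mu>)"
    unfolding f_def g_def
    by (intro nn_integral_cong arg_cong [where f = ennreal] norm_trace_integrand [OF z h _ nu])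
       (simp add: space_haar)
  also have "\<dots> = (\<integral>\<^sup>+k. ennreal (trace_kernel z u l k) \<partial>\<mu>)"
    by (rule nn_integral_haar_left [OF h]) measurable
  finally have *: "ennreal (norm (integral\<^sup>L \<mu> f)) \<le> (\<integral>\<^sup>+k. ennreal (trace_kernel z u l k) \<partial>\<mu>)" .
  have "cmod (spherical_trace \<mu> \<nu> l g) = (2 * real l + 1) * norm (integral\<^sup>L \<mu> f)"
    unfolding spherical_trace_def f_def norm_mult norm_of_nat by simp
  then show ?thesis
    unfolding g_def [symmetric] using * by (simp add: ennreal_mult mult_left_mono)
qed

text \<open>The l-th power is at most 1, and AM-GM bounds \<open>column_norm\<close> below by 2 |y|
  |z x + u y| / |z|. The product estimate with p = 1 and a = z then cancels |z|; 27 is 3 times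
  18/2.\<close>

lemma spherical_trace_bound_uniform:
  assumes z: "z \<noteq> 0" and h: "h \<in> SU2" and nu: "Re \<nu> = 0" and l: "l \<ge> 1"
  shows "cmod (spherical_trace \<mu> \<nu> l (matrix_inv h ** mat2 z u 0 (inverse z) ** h))
    \<le> 27 * neg_moment 1 * real l"
proof -
  let ?v = "\<lambda>k. cmod (k$2$1) * cmod (z * k$1$1 + u * k$2$1)"
  have pt: "trace_kernel z u l k \<le> cmod z / 2 * ?v k powr - 1"
    if k: "k \<in> SU2" and nz: "k$2$1 \<noteq> 0" "z * k$1$1 + u * k$2$1 \<noteq> 0" for k
  proof -
    define s where "s = column_norm z u k"
    have s: "s > 0" unfolding s_def by (rule column_norm_pos [OF z k])
    have v: "?v k > 0" using nz by simp
    have "2 * (cmod (z * k$1$1 + u * k$2$1) * cmod (inverse z * k$2$1)) \<le> s"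
      using sum_squares_bound [of "cmod (z * k$1$1 + u * k$2$1)" "cmod (inverse z * k$2$1)"]
      by (simp add: s_def column_norm_def)
    then have "2 * ?v k \<le> s * cmod z"
      unfolding norm_mult [of "inverse z"] norm_inverse using z by (simp add: field_simps)
    then have "1 / s \<le> cmod z / 2 / ?v k" using s v by (simp add: field_simps)
    moreover have "((s - (offdiag z u k)\<^sup>2) / s) ^ l \<le> 1"
      using s offdiag_le [OF k, of z u] by (intro power_le_one) (auto simp: s_def)
    then have "trace_kernel z u l k \<le> 1 / s"
      using s unfolding trace_kernel_def s_def [symmetric] by (intro divide_right_mono) auto
    ultimately show ?thesis using v by (simp add: powr_minus_divide)
  qed
  \<comment> \<open>Where the product vanishes, \<open>powr\<close> returns 0 and the majorant is
    useless, so the comparison is made almost everywhere.\<close>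
  have "AE k in \<mu>. k$2$1 \<noteq> 0" "AE k in \<mu>. z * k$1$1 + u * k$2$1 \<noteq> 0"
    using AE_linear_form_nonzero [of 0 1] AE_linear_form_nonzero [of z u] z by auto
  moreover have "AE k in \<mu>. k \<in> SU2" using AE_space [of \<mu>] by (simp add: space_haar)
  ultimately have "AE k in \<mu>. ennreal (trace_kernel z u l k) \<le> ennreal (cmod z / 2) * ennreal (?v k powr - 1)"
  proof eventually_elim
    case (elim k)
    then show ?case using pt [of k] by (simp add: ennreal_leI flip: ennreal_mult)
  qed
  then have "(\<integral>\<^sup>+k. ennreal (trace_kernel z u l k) \<partial>\<mu>) \<le>
      (\<integral>\<^sup>+k. ennreal (cmod z / 2) * ennreal (?v k powr - 1) \<partial>\<mu>)"
    by (rule nn_integral_mono_AE)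
  also have "\<dots> = ennreal (cmod z / 2) * (\<integral>\<^sup>+k. ennreal (?v k powr - 1) \<partial>\<mu>)"
    by (intro nn_integral_cmult measurable_haarI) measurable
  also have "\<dots> \<le> ennreal (cmod z / 2) * ennreal (18 * neg_moment 1 * cmod z powr - 1)"
    by (intro mult_left_mono nn_integral_product_powr z) auto
  also have "\<dots> = ennreal (9 * neg_moment 1)"
    using z neg_moment_nonneg [of 1] by (simp add: powr_minus_divide flip: ennreal_mult)
  finally have *: "(\<integral>\<^sup>+k. ennreal (trace_kernel z u l k) \<partial>\<mu>) \<le> ennreal (9 * neg_moment 1)" .
  have "ennreal (cmod (spherical_trace \<mu> \<nu> l (matrix_inv h ** mat2 z u 0 (inverse z) ** h)))
      \<le> ennreal (2 * real l + 1) * ennreal (9 * neg_moment 1)"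
    using norm_spherical_trace_le [OF z h nu] mult_left_mono [OF *] by (meson order_trans zero_le)
  also have "\<dots> = ennreal ((2 * real l + 1) * (9 * neg_moment 1))"
    using neg_moment_nonneg [of 1] by (intro ennreal_mult [symmetric]) auto
  finally have "cmod (spherical_trace \<mu> \<nu> l (matrix_inv h ** mat2 z u 0 (inverse z) ** h))
      \<le> (2 * real l + 1) * (9 * neg_moment 1)"
    using neg_moment_nonneg [of 1] by simp
  also have "\<dots> \<le> (3 * real l) * (9 * neg_moment 1)"
    using l neg_moment_nonneg [of 1] by (intro mult_right_mono) auto
  finally show ?thesis by (simp add: mult_ac)
qed

text \<open>Reduces the two decaying bounds to a negative moment of \<open>offdiag\<close>. The
  prefactor 2l + 1 <= 3l times the saving l^(-\<theta>) gives the power of l.\<close>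

lemma spherical_trace_bound_interpolated:
  assumes z: "z \<noteq> 0" and h: "h \<in> SU2" and nu: "Re \<nu> = 0" and l: "l \<ge> 1"
    and nd: "z - inverse z \<noteq> 0 \<or> u \<noteq> 0" and \<theta>: "0 \<le> \<theta>" "\<theta> \<le> 1" and B: "B \<ge> 0"
    and le: "(\<integral>\<^sup>+k. ennreal (offdiag z u k powr - (2 * \<theta>)) \<partial>\<mu>) \<le> ennreal B"
  shows "cmod (spherical_trace \<mu> \<nu> l (matrix_inv h ** mat2 z u 0 (inverse z) ** h))
    \<le> 3 * real l powr (1 - \<theta>) * frobenius_norm (mat2 z u 0 (inverse z)) powr (2 - 2 * \<theta>) * B"
proof -
  define N where "N = frobenius_norm (mat2 z u 0 (inverse z))"
  have N: "N \<ge> 1" unfolding N_def by (rule frobenius_norm_upper_ge(1) [OF z])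
  define c where "c = real l powr - \<theta> * N powr (2 - 2 * \<theta>)"
  have c: "c \<ge> 0" by (simp add: c_def)
  have "AE k in \<mu>. k$2$1 \<noteq> 0" "AE k in \<mu>. (z - inverse z) * k$1$1 + u * k$2$1 \<noteq> 0"
    using AE_linear_form_nonzero [of 0 1] AE_linear_form_nonzero [OF nd] by auto
  moreover have "AE k in \<mu>. k \<in> SU2" using AE_space [of \<mu>] by (simp add: space_haar)
  ultimately have "AE k in \<mu>. ennreal (trace_kernel z u l k) \<le>
      ennreal c * ennreal (offdiag z u k powr - (2 * \<theta>))"
  proof eventually_elim
    case (elim k)
    then have "trace_kernel z u l k \<le> c * offdiag z u k powr - (2 * \<theta>)"
      unfolding trace_kernel_def c_def using l N \<theta> column_norm_ge [OF z, of k u] offdiag_le [of k z u]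
      by (intro power_le_powr_bound) (auto simp: offdiag_def N_def)
    then show ?case using c by (simp add: ennreal_leI flip: ennreal_mult)
  qed
  then have "(\<integral>\<^sup>+k. ennreal (trace_kernel z u l k) \<partial>\<mu>) \<le>
      (\<integral>\<^sup>+k. ennreal c * ennreal (offdiag z u k powr - (2 * \<theta>)) \<partial>\<mu>)"
    by (rule nn_integral_mono_AE)
  also have "\<dots> = ennreal c * (\<integral>\<^sup>+k. ennreal (offdiag z u k powr - (2 * \<theta>)) \<partial>\<mu>)"
    by (intro nn_integral_cmult measurable_haarI) measurable
  also have "\<dots> \<le> ennreal c * ennreal B"
    by (intro mult_left_mono le) auto
  finally have *: "(\<integral>\<^sup>+k. ennreal (trace_kernel z u l k) \<partial>\<mu>) \<le> ennreal c * ennreal B" .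
  have "ennreal (cmod (spherical_trace \<mu> \<nu> l (matrix_inv h ** mat2 z u 0 (inverse z) ** h)))
      \<le> ennreal (2 * real l + 1) * (ennreal c * ennreal B)"
    using norm_spherical_trace_le [OF z h nu] mult_left_mono [OF *] by (meson order_trans zero_le)
  also have "\<dots> = ennreal ((2 * real l + 1) * (c * B))"
    using B c ennreal_mult [of c B] ennreal_mult [of "2 * real l + 1" "c * B"] by simp
  finally have "cmod (spherical_trace \<mu> \<nu> l (matrix_inv h ** mat2 z u 0 (inverse z) ** h))
      \<le> (2 * real l + 1) * (c * B)"
    using B c by simp
  also have "\<dots> \<le> (3 * real l) * (c * B)"
    using l B c by (intro mult_right_mono) auto
  also have "\<dots> = 3 * (real l * real l powr - \<theta>) * N powr (2 - 2 * \<theta>) * B"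
    by (simp add: c_def)
  also have "real l * real l powr - \<theta> = real l powr (1 - \<theta>)"
    using l by (simp add: powr_diff powr_minus_divide)
  finally show ?thesis by (simp add: N_def)
qed

text \<open>\<open>\<theta> = 1 - \<delta>\<close>, where the exponent \<open>2 * \<theta>\<close> of the product stays below 2.\<close>

lemma spherical_trace_bound_diagonal:
  fixes z u \<nu> :: complex
  assumes z: "z \<noteq> 0" and h: "h \<in> SU2" and nu: "Re \<nu> = 0" and l: "l \<ge> 1"
    and nd: "z\<^sup>2 \<noteq> 1" and \<delta>: "0 < \<delta>" "\<delta> \<le> 1/4"
  defines "N \<equiv> frobenius_norm (mat2 z u 0 (inverse z))"
  shows "cmod (spherical_trace \<mu> \<nu> l (matrix_inv h ** mat2 z u 0 (inverse z) ** h))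
    \<le> 108 * neg_moment (2 - 2 * \<delta>) * (real l powr \<delta> * N ^ 6 / (cmod (z\<^sup>2 - 1))\<^sup>2)"
proof -
  define J where "J = neg_moment (2 - 2 * \<delta>)"
  have J: "J \<ge> 0" unfolding J_def by (rule neg_moment_nonneg)
  note N = frobenius_norm_upper_ge [OF z, of u, folded N_def]
  define D where "D = cmod (z - inverse z)"
  have zD: "cmod (z\<^sup>2 - 1) = cmod z * D"
    using z by (simp add: D_def power2_eq_square algebra_simps flip: norm_mult)
  then have D: "D > 0" using nd by (auto simp: D_def)
  have D_le: "D \<le> 2 * N"
    unfolding D_def using norm_triangle_ineq4 [of z "inverse z"] N by linarith
  have "cmod (spherical_trace \<mu> \<nu> l (matrix_inv h ** mat2 z u 0 (inverse z) ** h))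
      \<le> 3 * real l powr (1 - (1 - \<delta>)) * N powr (2 - 2 * (1 - \<delta>)) * (18 * J * D powr - (2 - 2 * \<delta>))"
    unfolding N_def
  proof (rule spherical_trace_bound_interpolated [OF z h nu l])
    show "(\<integral>\<^sup>+k. ennreal (offdiag z u k powr - (2 * (1 - \<delta>))) \<partial>\<mu>) \<le>
        ennreal (18 * J * D powr - (2 - 2 * \<delta>))"
      using nn_integral_product_powr [of "z - inverse z" "2 - 2 * \<delta>" u] D \<delta>
      by (simp add: offdiag_def J_def D_def)
  qed (use \<delta> D J in \<open>auto simp: D_def\<close>)
  also have "\<dots> = 54 * J * real l powr \<delta> * (N powr (2 * \<delta>) * D powr (2 * \<delta>)) / D\<^sup>2"
    using D by (simp add: powr_diff)
  \<comment> \<open>The surplus powers are at most 2 N, since D <= 2 N and 4 \<delta> <= 1. From |z|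
    <= N follows N <= N^6/|z|^2, and |z|^2 D^2 is the desired denominator.\<close>
  also have "\<dots> \<le> 54 * J * real l powr \<delta> * (2 * (N ^ 6 / (cmod z)\<^sup>2)) / D\<^sup>2"
  proof (intro divide_right_mono mult_left_mono)
    have "D powr (2 * \<delta>) \<le> (2 * N) powr (2 * \<delta>)"
      using D_le D \<delta> by (intro powr_mono2) auto
    also have "\<dots> = 2 powr (2 * \<delta>) * N powr (2 * \<delta>)" by (simp add: powr_mult)
    also have "\<dots> \<le> 2 powr 1 * N powr (2 * \<delta>)"
      using \<delta> by (intro mult_right_mono powr_mono) auto
    finally have "N powr (2 * \<delta>) * D powr (2 * \<delta>) \<le> N powr (2 * \<delta>) * (2 * N powr (2 * \<delta>))"
      by (intro mult_left_mono) auto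
    also have "\<dots> = 2 * N powr (4 * \<delta>)" by (simp flip: powr_add)
    also have "\<dots> \<le> 2 * N powr 1"
      using \<delta> N by (intro mult_left_mono powr_mono) auto
    also have "N powr 1 \<le> N ^ 6 / (cmod z)\<^sup>2"
    proof -
      have "(cmod z)\<^sup>2 \<le> N\<^sup>2" using N by (intro power_mono) auto
      then have "N * (cmod z)\<^sup>2 \<le> N * N\<^sup>2" using N by (intro mult_left_mono) auto
      also have "\<dots> = N ^ 3" by (simp add: power3_eq_cube power2_eq_square)
      also have "\<dots> \<le> N ^ 6" using N by (intro power_increasing) auto
      finally show ?thesis using z N by (simp add: field_simps)
    qed
    finally show "N powr (2 * \<delta>) * D powr (2 * \<delta>) \<le> 2 * (N ^ 6 / (cmod z)\<^sup>2)" by simp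
  qed (use J in auto)
  finally show ?thesis by (simp add: zD J_def power_mult_distrib mult_ac)
qed

text \<open>\<open>\<theta> = 1/2 - \<delta>\<close>, which allows the product to be split by the inequality between the
  arithmetic and geometric means, without any lower bound on \<open>z - inverse z\<close>.\<close>

lemma spherical_trace_bound_offdiagonal:
  fixes z u \<nu> :: complex
  assumes z: "z \<noteq> 0" and h: "h \<in> SU2" and nu: "Re \<nu> = 0" and l: "l \<ge> 1"
    and nd: "u \<noteq> 0" and \<delta>: "0 < \<delta>" "\<delta> \<le> 1/4"
  defines "N \<equiv> frobenius_norm (mat2 z u 0 (inverse z))"
  shows "cmod (spherical_trace \<mu> \<nu> l (matrix_inv h ** mat2 z u 0 (inverse z) ** h))
    \<le> 18 * neg_moment (2 - 4 * \<delta>) * (real l powr (1/2 + \<delta>) * N ^ 3 / cmod u)"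
proof -
  define J where "J = neg_moment (2 - 4 * \<delta>)"
  have J: "J \<ge> 0" unfolding J_def by (rule neg_moment_nonneg)
  note N = frobenius_norm_upper_ge [OF z, of u, folded N_def]
  define L where "L = sqrt ((cmod (z - inverse z))\<^sup>2 + (cmod u)\<^sup>2)"
  have L: "L\<^sup>2 = (cmod (z - inverse z))\<^sup>2 + (cmod u)\<^sup>2" "L > 0"
    using nd by (auto simp: L_def intro: add_nonneg_pos)
  have uL: "cmod u \<le> L" by (auto simp: L_def intro: real_le_rsqrt)
  have L_le: "L \<le> 3 * N"
  proof -
    have "L \<le> cmod (z - inverse z) + cmod u"
      unfolding L_def by (rule sqrt_sum_squares_le_sum) auto
    then show ?thesis using norm_triangle_ineq4 [of z "inverse z"] N by linarith
  qed
  have "cmod (spherical_trace \<mu> \<nu> l (matrix_inv h ** mat2 z u 0 (inverse z) ** h))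
      \<le> 3 * real l powr (1 - (1/2 - \<delta>)) * N powr (2 - 2 * (1/2 - \<delta>)) * (L powr - (1 - 2 * \<delta>) * (2 * J))"
    unfolding N_def
  proof (rule spherical_trace_bound_interpolated [OF z h nu l])
    show "(\<integral>\<^sup>+k. ennreal (offdiag z u k powr - (2 * (1/2 - \<delta>))) \<partial>\<mu>) \<le>
        ennreal (L powr - (1 - 2 * \<delta>) * (2 * J))"
      \<comment> \<open>AM-GM doubles the exponent 1 - 2 \<delta> to 2 - 4 \<delta>, still below
        2.\<close>
      using nn_integral_product_powr' [OF L, of "1 - 2 * \<delta>"] \<delta>
      by (simp add: offdiag_def J_def algebra_simps)
  qed (use \<delta> nd J in auto)
  also have "\<dots> = 6 * J * real l powr (1/2 + \<delta>) * (N powr (1 + 2 * \<delta>) * L powr (2 * \<delta>)) / L"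
    using L by (simp add: powr_diff)
  \<comment> \<open>One power of \<open>L\<close> is replaced by |u| <= L; the surplus is absorbed
    by L <= 3 N and 1 + 4 \<delta> <= 3.\<close>
  also have "\<dots> \<le> 6 * J * real l powr (1/2 + \<delta>) * (3 * N ^ 3) / cmod u"
  proof (intro frac_le mult_left_mono)
    have "L powr (2 * \<delta>) \<le> (3 * N) powr (2 * \<delta>)"
      using L_le L \<delta> by (intro powr_mono2) auto
    also have "\<dots> = 3 powr (2 * \<delta>) * N powr (2 * \<delta>)" by (simp add: powr_mult)
    also have "\<dots> \<le> 3 powr 1 * N powr (2 * \<delta>)"
      using \<delta> by (intro mult_right_mono powr_mono) auto
    finally have "N powr (1 + 2 * \<delta>) * L powr (2 * \<delta>) \<le> N powr (1 + 2 * \<delta>) * (3 * N powr (2 * \<delta>))"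
      by (intro mult_left_mono) auto
    also have "\<dots> = 3 * N powr (1 + 4 * \<delta>)"
      by (simp add: algebra_simps flip: powr_add)
    also have "\<dots> \<le> 3 * N powr 3"
      using \<delta> N by (intro mult_left_mono powr_mono) auto
    finally show "N powr (1 + 2 * \<delta>) * L powr (2 * \<delta>) \<le> 3 * N ^ 3" using N by simp
  qed (use J N nd uL in auto)
  finally show ?thesis by (simp add: J_def mult_ac)
qed

end

theorem theorem4:
  fixes \<epsilon> :: real and \<mu> :: "(complex^2^2) measure"
  assumes "\<epsilon> > 0"
    and "haar_prob_measure SU2 \<mu>"
  shows "\<exists>C::real. \<forall>(l::nat) (z::complex) (u::complex) (\<nu>::complex) (k::complex^2^2) (g::complex^2^2).
           l \<ge> 1 \<longrightarrow> z \<noteq> 0 \<longrightarrow> g = mat2 z u 0 (inverse z) \<longrightarrow> Re \<nu> = 0 \<longrightarrow> k \<in> SU2 \<longrightarrow>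
           ereal (cmod (spherical_trace \<mu> \<nu> l (matrix_inv k ** g ** k)))
             \<le> ereal C * Min {ereal (real l),
                 ereal (real l powr \<epsilon> * frobenius_norm g ^ 6) / ereal ((cmod (z\<^sup>2 - 1))\<^sup>2),
                 ereal (real l powr (1/2 + \<epsilon>) * frobenius_norm g ^ 3) / ereal (cmod u)}"
proof -
  interpret haar_SU2 \<mu> using assms(2) by unfold_locales
  \<comment> \<open>Capped to suit the two bounds above; as l >= 1, passing from \<delta> back to
    \<epsilon> only enlarges the right-hand side.\<close>
  define \<delta> where "\<delta> = min \<epsilon> (1/4)"
  have \<delta>: "0 < \<delta>" "\<delta> \<le> 1/4" "\<delta> \<le> \<epsilon>" using assms(1) by (auto simp: \<delta>_def)
  \<comment> \<open>The summand 1 makes \<open>C\<close> positive, so that \<open>C\<close> times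
    infinity is infinity.\<close>
  define C where "C = 27 * neg_moment 1 + 108 * neg_moment (2 - 2 * \<delta>) + 18 * neg_moment (2 - 4 * \<delta>) + 1"
  have C: "27 * neg_moment 1 \<le> C" "108 * neg_moment (2 - 2 * \<delta>) \<le> C"
    "18 * neg_moment (2 - 4 * \<delta>) \<le> C" "C > 0"
    using neg_moment_nonneg [of 1] neg_moment_nonneg [of "2 - 2 * \<delta>"]
      neg_moment_nonneg [of "2 - 4 * \<delta>"] by (auto simp: C_def)
  have bound: "ereal (cmod (spherical_trace \<mu> \<nu> l (matrix_inv k ** g ** k)))
      \<le> ereal C * Min {ereal (real l),
          ereal (real l powr \<epsilon> * frobenius_norm g ^ 6) / ereal ((cmod (z\<^sup>2 - 1))\<^sup>2),
          ereal (real l powr (1/2 + \<epsilon>) * frobenius_norm g ^ 3) / ereal (cmod u)}" (is "ereal ?A \<le> _ * Min ?S")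
    if l: "l \<ge> 1" and z: "z \<noteq> 0" and g: "g = mat2 z u 0 (inverse z)" and nu: "Re \<nu> = 0"
      and k: "k \<in> SU2" for l z u \<nu> k g
  proof -
    define N where "N = frobenius_norm g"
    have N: "N \<ge> 1" unfolding N_def g by (rule frobenius_norm_upper_ge(1) [OF z])
    have 1: "ereal ?A \<le> ereal C * ereal (real l)"
    proof -
      have "?A \<le> 27 * neg_moment 1 * real l"
        unfolding g by (rule spherical_trace_bound_uniform [OF z k nu l])
      also have "\<dots> \<le> C * real l" using C by (intro mult_right_mono) auto
      finally show ?thesis by simp
    qed
    have 2: "ereal ?A \<le> ereal C * (ereal (real l powr \<epsilon> * N ^ 6) / ereal ((cmod (z\<^sup>2 - 1))\<^sup>2))"
    proof (cases "z\<^sup>2 = 1")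
      \<comment> \<open>In \<open>ereal\<close> a positive number over 0 is infinity, and the
        numerator is positive because l and \<open>N\<close> are at least 1.\<close>
      case True
      then show ?thesis using C N l by simp
    next
      case False
      have "?A \<le> 108 * neg_moment (2 - 2 * \<delta>) * (real l powr \<delta> * N ^ 6 / (cmod (z\<^sup>2 - 1))\<^sup>2)"
        unfolding N_def g by (rule spherical_trace_bound_diagonal [OF z k nu l False \<delta>(1,2)])
      also have "\<dots> \<le> C * (real l powr \<epsilon> * N ^ 6 / (cmod (z\<^sup>2 - 1))\<^sup>2)"
        using C N l \<delta> by (intro mult_mono divide_right_mono powr_mono) auto
      finally show ?thesis using False by simp
    qed
    have 3: "ereal ?A \<le> ereal C * (ereal (real l powr (1/2 + \<epsilon>) * N ^ 3) / ereal (cmod u))"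
    proof (cases "u = 0")
      case True
      then show ?thesis using C N l by simp
    next
      case False
      have "?A \<le> 18 * neg_moment (2 - 4 * \<delta>) * (real l powr (1/2 + \<delta>) * N ^ 3 / cmod u)"
        unfolding N_def g by (rule spherical_trace_bound_offdiagonal [OF z k nu l False \<delta>(1,2)])
      also have "\<dots> \<le> C * (real l powr (1/2 + \<epsilon>) * N ^ 3 / cmod u)"
        using C N l \<delta> by (intro mult_mono divide_right_mono powr_mono) auto
      finally show ?thesis using False by simp
    qed
    have "Min ?S \<in> ?S" by (rule Min_in) auto
    then show ?thesis using 1 2 3 unfolding N_def insert_iff empty_iff by (elim disjE) (simp_all only:)
  qed
  show ?thesis by (rule exI [of _ C], intro allI impI, rule bound; assumption)
qed

end
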